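(* Let $f_{\mathrm{CRLB}}(\mathbf{X})=\sigma_{\mathrm r}^2\,\mathrm{tr}\big(\mathbf{F}_\vartheta^{-1}\big)$ be the CRLB metric, defined for those $\mathbf{X}\in\mathbb{C}^{N\times\tau}$ for which $\mathbf{T}_\alpha^{\mathrm H}\tilde{\mathbf{X}}\mathbf{T}_\alpha$ and $\mathbf{F}_\vartheta$ are invertible, where $\tilde{\mathbf{X}}=(\mathbf{X}^*\mathbf{X}^{\mathrm T})\otimes\mathbf{I}_N$ and $$\mathbf{F}_\vartheta=\mathbf{T}_\vartheta^{\mathrm H}\tilde{\mathbf{X}}\mathbf{T}_\vartheta-\mathbf{T}_\vartheta^{\mathrm H}\tilde{\mathbf{X}}\mathbf{T}_\alpha\big(\mathbf{T}_\alpha^{\mathrm H}\tilde{\mathbf{X}}\mathbf{T}_\alpha\big)^{-1}\mathbf{T}_\alpha^{\mathrm H}\tilde{\mathbf{X}}\mathbf{T}_\vartheta .$$ Let $\boldsymbol{\Upsilon}_\vartheta=\mathbf{T}_\vartheta\mathbf{F}_\vartheta^{-2}\mathbf{T}_\vartheta^{\mathrm H}$ and $\boldsymbol{\Upsilon}_\alpha=(\mathbf{T}_\alpha^{\mathrm H}\tilde{\mathbf{X}}\mathbf{T}_\alpha)^{-1}$. Then for every such $\mathbf{X}$ the Euclidean gradient of $f_{\mathrm{CRLB}}$ with respect to $\mathbf{X}$ is $$\nabla f_{\mathrm{CRLB}}(\mathbf{X})=\sigma_{\mathrm r}^2\,\tilde{\mathbf{V}}^{\mathrm T}\mathbf{X},$$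 where $\tilde{\mathbf{V}}\in\mathbb{C}^{N\times N}$ has $(n,m)$-th element $[\tilde{\mathbf{V}}]_{n,m}=\mathrm{tr}\big(\mathbf{V}_{(n-1)N+1:nN,\,(m-1)N+1:mN}\big)$ and $\mathbf{V}\in\mathbb{C}^{N^2\times N^2}$ is $$\mathbf{V}=-\boldsymbol{\Upsilon}_\vartheta+\mathbf{T}_\alpha\boldsymbol{\Upsilon}_\alpha\mathbf{T}_\alpha^{\mathrm H}\tilde{\mathbf{X}}\boldsymbol{\Upsilon}_\vartheta-\mathbf{T}_\alpha\boldsymbol{\Upsilon}_\alpha\mathbf{T}_\alpha^{\mathrm H}\tilde{\mathbf{X}}\boldsymbol{\Upsilon}_\vartheta\tilde{\mathbf{X}}\mathbf{T}_\alpha\boldsymbol{\Upsilon}_\alpha\mathbf{T}_\alpha^{\mathrm H}+\boldsymbol{\Upsilon}_\vartheta\tilde{\mathbf{X}}\mathbf{T}_\alpha\boldsymbol{\Upsilon}_\alpha\mathbf{T}_\alpha^{\mathrm H}.$$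
   Context: $N,\tau,K\ge1$ are integers, $\sigma_{\mathrm r}^2>0$ is the noise variance, and $\mathbf{a}:\mathbb{R}\to\mathbb{C}^N$ is a differentiable array steering vector. The target parameters are the amplitudes $\alpha_1,\dots,\alpha_K\in\mathbb{C}$ and the angles $\vartheta_1,\dots,\vartheta_K\in\mathbb{R}$, which are fixed. Put $\mathbf{g}=\mathrm{vec}\big(\sum_{k=1}^K\alpha_k\mathbf{a}(\vartheta_k)\mathbf{a}(\vartheta_k)^{\mathrm H}\big)\in\mathbb{C}^{N^2}$ (column stacking). The matrices $\mathbf{T}_\alpha,\mathbf{T}_\vartheta\in\mathbb{C}^{N^2\times K}$ are the blocks of the Jacobian $[\mathbf{T}_\alpha\ \mathbf{T}_\vartheta]$ of $\mathbf{g}$ with respect to $(\alpha_1,\dots,\alpha_K,\vartheta_1,\dots,\vartheta_K)$: the $k$-th column of $\mathbf{T}_\alpha$ is $\partial\mathbf{g}/\partial\alpha_k$ and the $k$-th column of $\mathbf{T}_\vartheta$ is $\partial\mathbf{g}/\partial\vartheta_k$. They do not depend on $\mathbf{X}$. Here $(\cdot)^*$, $(\cdot)^{\mathrm T}$, $(\cdot)^{\mathrm H}$ are conjugate, transpose and conjugate transpose, $\otimes$ is the Kronecker product, and $\mathbf{V}_{i:j,k:\ell}$ is the submatrix of $\mathbf{V}$ formed by rows $i$ to $j$ and columns $k$ to $\ell$. Convention: for a real-valued function $f$ of a complex matrix $\mathbf{X}\in\mathbb{C}^{N\times\tau}$, the Euclidean gradient $\nabla f(\mathbf{X})\in\mathbb{C}^{N\times\tau}$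 is the matrix of Wirtinger derivatives with $(n,t)$ entry $\partial f/\partial X_{n,t}^*=\frac12\big(\partial f/\partial\Re X_{n,t}+\mathrm{j}\,\partial f/\partial\Im X_{n,t}\big)$, where $\mathrm{j}$ is the imaginary unit. Equivalently, $df=\mathrm{tr}\big((d\mathbf{X})^{\mathrm H}\nabla f(\mathbf{X})\big)+\mathrm{tr}\big(\nabla f(\mathbf{X})^{\mathrm H}d\mathbf{X}\big)$. *)

theory Defs
  imports "HOL-Analysis.Analysis"
begin

definition mat_cnj :: "complex^'m^'n \<Rightarrow> complex^'m^'n" where
  "mat_cnj A = (\<chi> i j. cnj (A $ i $ j))"

definition mat_adjoint :: "complex^'m^'n \<Rightarrow> complex^'n^'m"  (\<open>(_\<^sup>H)\<close> [1000] 999) where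
  "A\<^sup>H = transpose (mat_cnj A)"

text \<open>
  Vectors and matrices of size \<open>N\<^sup>2\<close> are indexed by the pair type \<open>'n \<times> 'n\<close>, listed
  lexicographically: the pair \<open>(n, i)\<close> stands for the position \<open>(n - 1) N + i\<close>, so the first
  component selects a block and the second a position inside the block. Column stacking therefore
  puts the entry in row \<open>i\<close> and column \<open>n\<close> at index \<open>(n, i)\<close>.
\<close>

definition column_stack :: "'a^'m^'n \<Rightarrow> 'a^('m \<times> 'n)" where
  "column_stack A = (\<chi> p. A $ snd p $ fst p)"

definition kronecker :: "complex^'m^'n \<Rightarrow> complex^'q^'p \<Rightarrow> complex^('m \<times> 'q)^('n \<times> 'p)"
    (infixl \<open>\<otimes>\<^sub>K\<close> 72) where
  "A \<otimes>\<^sub>K B = (\<chi> r c. A $ fst r $ fst c * B $ snd r $ snd c)"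

definition block :: "'a^('n \<times> 'n)^('n \<times> 'n) \<Rightarrow> 'n \<Rightarrow> 'n \<Rightarrow> 'a^'n^'n" where
  "block V n m = (\<chi> i j. V $ (n, i) $ (m, j))"

definition block_traces :: "complex^('n \<times> 'n)^('n \<times> 'n) \<Rightarrow> complex^'n^'n" where
  "block_traces V = (\<chi> n m. trace (block V n m))"

definition vec_upd :: "'a^'k \<Rightarrow> 'k \<Rightarrow> 'a \<Rightarrow> 'a^'k" where
  "vec_upd v k x = (\<chi> l. if l = k then x else v $ l)"

definition mat_unit :: "'n \<Rightarrow> 't \<Rightarrow> complex^'t^'n" where
  "mat_unit n t = (\<chi> i j. if i = n \<and> j = t then 1 else 0)"

text \<open>
  The matrix of derivatives with respect to the conjugated entries. It is meant for \<open>f\<close> that is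
  real-differentiable at \<open>X\<close> and takes real values near \<open>X\<close>; \<open>vector_derivative\<close> is unspecified
  when the partial derivatives do not exist.
\<close>

definition euclidean_gradient :: "(complex^'t^'n \<Rightarrow> complex) \<Rightarrow> complex^'t^'n \<Rightarrow> complex^'t^'n" where
  "euclidean_gradient f X = (\<chi> n t.
     (vector_derivative (\<lambda>s::real. f (X + s *\<^sub>R mat_unit n t)) (at 0)
      + \<i> * vector_derivative (\<lambda>s::real. f (X + s *\<^sub>R (\<chi> i j. \<i> * mat_unit n t $ i $ j))) (at 0)) / 2)"

definition target_response ::
    "(real \<Rightarrow> complex^'n) \<Rightarrow> complex^'k \<Rightarrow> real^'k \<Rightarrow> complex^('n \<times> 'n)" where
  "target_response a \<alpha> \<theta> =
     column_stack (\<chi> i j. \<Sum>k\<in>UNIV. \<alpha> $ k * (a (\<theta> $ k) $ i * cnj (a (\<theta> $ k) $ j)))"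

definition T_alpha ::
    "(real \<Rightarrow> complex^'n) \<Rightarrow> complex^'k \<Rightarrow> real^'k \<Rightarrow> complex^'k^('n \<times> 'n)" where
  "T_alpha a \<alpha> \<theta> =
     (\<chi> p k. deriv (\<lambda>z. target_response a (vec_upd \<alpha> k z) \<theta> $ p) (\<alpha> $ k))"

definition T_theta ::
    "(real \<Rightarrow> complex^'n) \<Rightarrow> complex^'k \<Rightarrow> real^'k \<Rightarrow> complex^'k^('n \<times> 'n)" where
  "T_theta a \<alpha> \<theta> =
     (\<chi> p k. vector_derivative (\<lambda>s. target_response a \<alpha> (vec_upd \<theta> k s) $ p) (at (\<theta> $ k)))"

definition X_tilde :: "complex^'t^'n \<Rightarrow> complex^('n \<times> 'n)^('n \<times> 'n)" where
  "X_tilde X = (mat_cnj X ** transpose X) \<otimes>\<^sub>K mat 1"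

definition F_alpha ::
    "(real \<Rightarrow> complex^'n) \<Rightarrow> complex^'k \<Rightarrow> real^'k \<Rightarrow> complex^'t^'n \<Rightarrow> complex^'k^'k" where
  "F_alpha a \<alpha> \<theta> X = (T_alpha a \<alpha> \<theta>)\<^sup>H ** X_tilde X ** T_alpha a \<alpha> \<theta>"

definition F_theta ::
    "(real \<Rightarrow> complex^'n) \<Rightarrow> complex^'k \<Rightarrow> real^'k \<Rightarrow> complex^'t^'n \<Rightarrow> complex^'k^'k" where
  "F_theta a \<alpha> \<theta> X =
     (let Ta = T_alpha a \<alpha> \<theta>; Tt = T_theta a \<alpha> \<theta>; Xt = X_tilde X
      in Tt\<^sup>H ** Xt ** Tt
         - Tt\<^sup>H ** Xt ** Ta ** matrix_inv (F_alpha a \<alpha> \<theta> X) ** Ta\<^sup>H ** Xt ** Tt)"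

text \<open>
  Only meaningful where \<open>F_alpha\<close> and \<open>F_theta\<close> are invertible, which is an open condition on \<open>X\<close>;
  \<open>\<sigma>\<^sup>2\<close> is the noise variance.
\<close>

definition f_CRLB ::
    "real \<Rightarrow> (real \<Rightarrow> complex^'n) \<Rightarrow> complex^'k \<Rightarrow> real^'k \<Rightarrow> complex^'t^'n \<Rightarrow> complex" where
  "f_CRLB \<sigma> a \<alpha> \<theta> X = complex_of_real (\<sigma>\<^sup>2) * trace (matrix_inv (F_theta a \<alpha> \<theta> X))"

definition Upsilon_alpha ::
    "(real \<Rightarrow> complex^'n) \<Rightarrow> complex^'k \<Rightarrow> real^'k \<Rightarrow> complex^'t^'n \<Rightarrow> complex^'k^'k" where
  "Upsilon_alpha a \<alpha> \<theta> X = matrix_inv (F_alpha a \<alpha> \<theta> X)"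

definition Upsilon_theta ::
    "(real \<Rightarrow> complex^'n) \<Rightarrow> complex^'k \<Rightarrow> real^'k \<Rightarrow> complex^'t^'n
      \<Rightarrow> complex^('n \<times> 'n)^('n \<times> 'n)" where
  "Upsilon_theta a \<alpha> \<theta> X =
     T_theta a \<alpha> \<theta> ** (matrix_inv (F_theta a \<alpha> \<theta> X) ** matrix_inv (F_theta a \<alpha> \<theta> X))
       ** (T_theta a \<alpha> \<theta>)\<^sup>H"

definition V_mat ::
    "(real \<Rightarrow> complex^'n) \<Rightarrow> complex^'k \<Rightarrow> real^'k \<Rightarrow> complex^'t^'n
      \<Rightarrow> complex^('n \<times> 'n)^('n \<times> 'n)" where
  "V_mat a \<alpha> \<theta> X =
     (let Ta = T_alpha a \<alpha> \<theta>; Xt = X_tilde X;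
          Ua = Upsilon_alpha a \<alpha> \<theta> X; Ut = Upsilon_theta a \<alpha> \<theta> X
      in - Ut
         + Ta ** Ua ** Ta\<^sup>H ** Xt ** Ut
         - Ta ** Ua ** Ta\<^sup>H ** Xt ** Ut ** Xt ** Ta ** Ua ** Ta\<^sup>H
         + Ut ** Xt ** Ta ** Ua ** Ta\<^sup>H)"

end

theory Submission
  imports Defs
begin

text \<open>
  Since \<open>d(A\<^sup>-\<^sup>1) = - A\<^sup>-\<^sup>1 dA A\<^sup>-\<^sup>1\<close>, differentiating the Schur complement \<open>F\<^sub>\<theta>\<close> and
  rotating every trace so that the differential of \<open>W = X\<^sup>* X\<^sup>T \<otimes> I\<close> stands last gives
  \<open>d tr(F\<^sub>\<theta>\<^sup>-\<^sup>1) = tr(V dW)\<close>. Writing \<open>V'\<close> for the matrix of block traces, which absorbs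
  the factor \<open>\<otimes> I\<close>, this is \<open>tr(V' dX\<^sup>* X\<^sup>T) + tr(V' X\<^sup>* dX\<^sup>T)\<close>, of which the
  Wirtinger derivative with respect to the conjugated entries sees only the first summand.
\<close>

section \<open>Algebra of matrix products and inverses\<close>

lemma invertible_matrix_inv:
  assumes "invertible A"
  shows "A ** matrix_inv A = mat 1" and "matrix_inv A ** A = mat 1"
  using assms unfolding invertible_def matrix_inv_def
  by (metis (mono_tags, lifting) someI_ex)+

lemma matrix_inv_eqI:
  fixes A :: "'a::semiring_1^'n^'n"
  assumes "A ** B = mat 1" and "B ** A = mat 1"
  shows "matrix_inv A = B"
proof -
  have "invertible A"
    using assms unfolding invertible_def by blast
  then show ?thesis
    by (metis assms(2) invertible_matrix_inv(1) matrix_mul_assoc matrix_mul_lid matrix_mul_rid)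
qed

lemma matrix_add_rdistrib: "(A + B) ** C = A ** C + B ** (C :: 'a::semiring_1^'m^'n)"
  by (simp add: vec_eq_iff matrix_matrix_mult_def algebra_simps sum.distrib)

lemma matrix_diff_ldistrib: "A ** (B - C) = A ** B - A ** (C :: 'a::ring_1^'m^'n)"
  by (simp add: vec_eq_iff matrix_matrix_mult_def algebra_simps sum_subtractf)

lemma matrix_diff_rdistrib: "(A - B) ** C = A ** C - B ** (C :: 'a::ring_1^'m^'n)"
  by (simp add: vec_eq_iff matrix_matrix_mult_def algebra_simps sum_subtractf)

lemma matrix_minus_left: "(- A) ** B = - (A ** (B :: 'a::ring_1^'m^'n))"
  by (simp add: vec_eq_iff matrix_matrix_mult_def sum_negf)

lemma matrix_minus_right: "A ** (- B) = - (A ** (B :: 'a::ring_1^'m^'n))"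
  by (simp add: vec_eq_iff matrix_matrix_mult_def sum_negf)

text \<open>In finite dimensions every bilinear map is bounded, so an entrywise check of bilinearity
  suffices. This supplies both the product rule and the norm estimate used for the inverse.\<close>

lemma bounded_bilinear_matrix_mult:
  "bounded_bilinear
    ((**) :: 'a::{real_normed_field,euclidean_space}^'m^'n \<Rightarrow> 'a^'p^'m \<Rightarrow> 'a^'p^'n)"
  unfolding bilinear_conv_bounded_bilinear[symmetric] bilinear_def
  by (auto intro!: linearI simp: vec_eq_iff matrix_matrix_mult_def
      algebra_simps sum.distrib scaleR_sum_right)

section \<open>Continuity and derivative of the matrix inverse\<close>

lemma tendsto_det [tendsto_intros]:
  fixes A :: "'b \<Rightarrow> 'a::real_normed_field^'n^'n"
  assumes "(A \<longlongrightarrow> L) F"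
  shows "((\<lambda>x. det (A x)) \<longlongrightarrow> det L) F"
  unfolding det_def by (intro tendsto_intros assms)

text \<open>Column \<open>j\<close> of the inverse solves the linear system with right-hand side
  \<open>axis j 1\<close>, so Cramer's rule applies. As quotients of determinants the entries
  inherit continuity from \<open>det\<close>.\<close>

lemma matrix_inv_cramer:
  fixes A :: "'a::field^'n^'n"
  assumes "invertible A"
  shows "matrix_inv A =
    (\<chi> k j. det (\<chi> i l. if l = k then axis j 1 $ i else A $ i $ l) / det A)"
proof -
  have "A *v column j (matrix_inv A) = axis j 1" for j
    using invertible_matrix_inv(1)[OF assms]
    by (simp add: vec_eq_iff matrix_matrix_mult_def matrix_vector_mult_def column_def mat_def
        axis_def)
  moreover have "det A \<noteq> 0"
    using assms by (simp add: invertible_det_nz)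
  ultimately have "column j (matrix_inv A) =
      (\<chi> k. det (\<chi> i l. if l = k then axis j 1 $ i else A $ i $ l) / det A)" for j
    by (simp add: cramer)
  then show ?thesis
    by (simp add: vec_eq_iff column_def)
qed

lemma tendsto_matrix_inv:
  fixes A :: "'b \<Rightarrow> 'a::real_normed_field^'n^'n"
  assumes A: "(A \<longlongrightarrow> L) F" and L: "invertible L"
  shows "((\<lambda>x. matrix_inv (A x)) \<longlongrightarrow> matrix_inv L) F"
proof -
  have nz: "det L \<noteq> 0"
    using L by (simp add: invertible_det_nz)
  have "((\<lambda>x. \<chi> k j. det (\<chi> i l. if l = k then axis j 1 $ i else A x $ i $ l) / det (A x))
      \<longlongrightarrow> (\<chi> k j. det (\<chi> i l. if l = k then axis j 1 $ i else L $ i $ l) / det L)) F"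
  proof (intro tendsto_vec_lambda tendsto_divide tendsto_det A nz)
    fix k j i l
    show "((\<lambda>x. if l = k then axis j 1 $ i else A x $ i $ l)
        \<longlongrightarrow> (if l = k then axis j 1 $ i else L $ i $ l)) F"
      by (cases "l = k") (auto intro!: tendsto_intros A)
  qed
  \<comment> \<open>Cramer's formula agrees with \<open>matrix_inv\<close> only at invertible
    matrices; invertibility of the limit \<open>L\<close> forces it eventually along
    \<open>F\<close>.\<close>
  moreover have "\<forall>\<^sub>F x in F. det (A x) \<noteq> 0"
    using tendsto_imp_eventually_ne[OF tendsto_det[OF A] nz] .
  ultimately show ?thesis
    unfolding matrix_inv_cramer[OF L]
    by (elim Lim_transform_eventually)
      (auto elim!: eventually_mono simp: matrix_inv_cramer invertible_det_nz)
qed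

text \<open>
  With continuity of the inverse known, the first-order error is
  \<open>(L\<^sup>-\<^sup>1 - M\<^sup>-\<^sup>1) (M - L) L\<^sup>-\<^sup>1 = o(M - L)\<close>.
\<close>
lemma has_derivative_matrix_inv_at:
  fixes L :: "'a::{real_normed_field,euclidean_space}^'n^'n"
  assumes L: "invertible L"
  shows "(matrix_inv has_derivative (\<lambda>H. - (matrix_inv L ** H ** matrix_inv L))) (at L)"
proof -
  interpret mm: bounded_bilinear
    "(**) :: 'a^'n^'n \<Rightarrow> 'a^'n^'n \<Rightarrow> 'a^'n^'n"
    by (rule bounded_bilinear_matrix_mult)
  let ?i = "matrix_inv :: 'a^'n^'n \<Rightarrow> 'a^'n^'n"
  obtain K where K: "\<And>(A :: 'a^'n^'n) (B :: 'a^'n^'n). norm (A ** B) \<le> norm A * norm B * K"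
    and "K > 0"
    using mm.pos_bounded by blast
  have cont: "(?i \<longlongrightarrow> ?i L) (at L)"
    by (rule tendsto_matrix_inv[OF tendsto_ident_at L])
  have "\<forall>\<^sub>F M in at L. det M \<noteq> 0"
    using L by (intro tendsto_imp_eventually_ne[OF tendsto_det[OF tendsto_ident_at]])
      (simp add: invertible_det_nz)
  then have ev: "\<forall>\<^sub>F M in at L.
      norm (norm (?i M - ?i L - - (?i L ** (M - L) ** ?i L)) / norm (M - L))
        \<le> norm (?i L - ?i M) * (norm (?i L) * K * K)"
  proof (rule eventually_mono)
    fix M :: "'a^'n^'n"
    assume "det M \<noteq> 0"
    then have M: "invertible M"
      by (simp add: invertible_det_nz)
    \<comment> \<open>The resolvent identity; it turns the first-order error into a product with two
      small factors.\<close>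
    have "?i M ** (M - L) ** ?i L = ?i L - ?i M"
      using invertible_matrix_inv[OF M] invertible_matrix_inv[OF L]
      by (simp add: mm.diff_left mm.diff_right matrix_mul_assoc[symmetric])
    then have "?i M - ?i L - - (?i L ** (M - L) ** ?i L) = (?i L - ?i M) ** ((M - L) ** ?i L)"
      by (simp add: mm.diff_left[of "?i L" "?i M"] mm.diff_left[of "?i L ** (M - L)"]
          matrix_mul_assoc)
    also have "norm \<dots> \<le> norm (?i L - ?i M) * norm ((M - L) ** ?i L) * K"
      by (rule K)
    also have "\<dots> \<le> norm (?i L - ?i M) * (norm (M - L) * norm (?i L) * K) * K"
      using \<open>K > 0\<close> by (intro mult_right_mono mult_left_mono K) auto
    \<comment> \<open>The condition \<open>det M \<noteq> 0\<close> allows \<open>M = L\<close>;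
      there the numerator and the bound both vanish, and the quotient 0 / 0 is 0.\<close>
    finally show "norm (norm (?i M - ?i L - - (?i L ** (M - L) ** ?i L)) / norm (M - L))
        \<le> norm (?i L - ?i M) * (norm (?i L) * K * K)"
      using \<open>K > 0\<close> by (cases "M = L") (auto simp: divide_le_eq mult_ac)
  qed
  have "((\<lambda>M. norm (?i L - ?i M) * (norm (?i L) * K * K)) \<longlongrightarrow> 0) (at L)"
    by (rule tendsto_eq_intros cont refl | simp)+
  then have "((\<lambda>M. norm (?i M - ?i L - - (?i L ** (M - L) ** ?i L)) / norm (M - L))
      \<longlongrightarrow> 0) (at L)"
    by (rule Lim_null_comparison[OF ev])
  moreover have "bounded_linear (\<lambda>H. - (?i L ** H ** ?i L))"
    by (intro bounded_linear_minus
        bounded_linear_compose[OF mm.bounded_linear_left mm.bounded_linear_right])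
  ultimately show ?thesis
    by (simp add: has_derivative_iff_norm)
qed

lemma has_derivative_matrix_inv:
  fixes f :: "'b::real_normed_vector \<Rightarrow> 'a::{real_normed_field,euclidean_space}^'n^'n"
  assumes "(f has_derivative f') (at x within S)" and "invertible (f x)"
  shows "((\<lambda>y. matrix_inv (f y)) has_derivative
    (\<lambda>h. - (matrix_inv (f x) ** f' h ** matrix_inv (f x)))) (at x within S)"
  by (rule has_derivative_compose[OF assms(1) has_derivative_matrix_inv_at[OF assms(2)]])

section \<open>Linear maps entering the metric and the differential of
  \<open>X_tilde\<close>\<close>

lemma trace_minus: "trace (- A) = - trace (A :: 'a::ring_1^'n^'n)"
  by (simp add: trace_def sum_negf)

lemma bounded_linear_trace:
  "bounded_linear (trace :: 'a::{real_normed_field,euclidean_space}^'n^'n \<Rightarrow> 'a)"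
  unfolding linear_conv_bounded_linear[symmetric]
  by (auto intro!: linearI simp: trace_def sum.distrib scaleR_sum_right)

lemma bounded_linear_mat_cnj: "bounded_linear mat_cnj"
  unfolding linear_conv_bounded_linear[symmetric]
  by (auto intro!: linearI simp: mat_cnj_def vec_eq_iff)

lemma bounded_linear_transpose:
  "bounded_linear (transpose :: 'a::euclidean_space^'m^'n \<Rightarrow> 'a^'n^'m)"
  unfolding linear_conv_bounded_linear[symmetric]
  by (auto intro!: linearI simp: transpose_def vec_eq_iff)

lemma bounded_linear_kronecker_left: "bounded_linear (\<lambda>A. A \<otimes>\<^sub>K B)"
  unfolding linear_conv_bounded_linear[symmetric]
  by (auto intro!: linearI simp: kronecker_def vec_eq_iff algebra_simps)

lemmas has_derivative_matrix_mult = bounded_bilinear.FDERIV[OF bounded_bilinear_matrix_mult]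

text \<open>Conjugation is real-linear but not complex-linear, so this is a derivative over the
  reals. It is the product rule followed by the linear map
  \<open>\<lambda>A. A \<otimes>\<^sub>K mat 1\<close>.\<close>

lemma has_derivative_X_tilde:
  "(X_tilde has_derivative
    (\<lambda>H. (mat_cnj X ** transpose H + mat_cnj H ** transpose X) \<otimes>\<^sub>K mat 1)) (at X)"
  unfolding X_tilde_def
  by (intro bounded_linear.has_derivative[OF bounded_linear_kronecker_left]
      has_derivative_matrix_mult
      bounded_linear_imp_has_derivative bounded_linear_mat_cnj bounded_linear_transpose)

section \<open>Hermitian symmetry and real values of the metric\<close>

lemma adjoint_matrix_mult: "(A ** B)\<^sup>H = B\<^sup>H ** A\<^sup>H"
  by (simp add: mat_adjoint_def mat_cnj_def transpose_def matrix_matrix_mult_def vec_eq_iff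
      mult.commute)

lemma adjoint_adjoint: "(A\<^sup>H)\<^sup>H = A"
  by (simp add: mat_adjoint_def mat_cnj_def transpose_def vec_eq_iff)

lemma adjoint_diff: "(A - B)\<^sup>H = A\<^sup>H - B\<^sup>H"
  by (simp add: mat_adjoint_def mat_cnj_def transpose_def vec_eq_iff)

lemma adjoint_mat_1: "(mat 1)\<^sup>H = mat 1"
  by (auto simp add: mat_adjoint_def mat_cnj_def transpose_def mat_def vec_eq_iff)

lemma adjoint_matrix_inv:
  fixes A :: "complex^'n^'n"
  assumes "invertible A"
  shows "(matrix_inv A)\<^sup>H = matrix_inv (A\<^sup>H)"
  by (rule matrix_inv_eqI[symmetric])
    (simp_all add: adjoint_matrix_mult[symmetric] adjoint_mat_1 invertible_matrix_inv[OF assms])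

lemma trace_adjoint: "trace (A\<^sup>H) = cnj (trace A)"
  by (simp add: trace_def mat_adjoint_def mat_cnj_def transpose_def)

text \<open>Since \<open>transpose X\<close> is the adjoint of \<open>mat_cnj X\<close>, the first
  Kronecker factor has the form \<open>M ** M\<^sup>H\<close>; the second is the identity.\<close>

lemma adjoint_X_tilde: "(X_tilde X)\<^sup>H = X_tilde X"
  by (auto simp: X_tilde_def kronecker_def mat_adjoint_def mat_cnj_def transpose_def mat_def
      matrix_matrix_mult_def vec_eq_iff mult.commute intro!: sum.cong)

lemma adjoint_F_alpha: "(F_alpha a \<alpha> \<theta> X)\<^sup>H = F_alpha a \<alpha> \<theta> X"
  by (simp add: F_alpha_def adjoint_matrix_mult adjoint_adjoint adjoint_X_tilde matrix_mul_assoc)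

lemma adjoint_F_theta:
  assumes "invertible (F_alpha a \<alpha> \<theta> X)"
  shows "(F_theta a \<alpha> \<theta> X)\<^sup>H = F_theta a \<alpha> \<theta> X"
  by (simp add: F_theta_def Let_def adjoint_diff adjoint_matrix_mult adjoint_adjoint adjoint_X_tilde
      adjoint_matrix_inv[OF assms] adjoint_F_alpha matrix_mul_assoc)

text \<open>The inverse of the Hermitian matrix \<open>F_theta\<close> is Hermitian, so its trace
  equals its own conjugate.\<close>

lemma f_CRLB_real:
  assumes "invertible (F_alpha a \<alpha> \<theta> X)" and "invertible (F_theta a \<alpha> \<theta> X)"
  shows "f_CRLB \<sigma> a \<alpha> \<theta> X \<in> \<real>"
proof -
  have "cnj (trace (matrix_inv (F_theta a \<alpha> \<theta> X))) = trace (matrix_inv (F_theta a \<alpha> \<theta> X))"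
    unfolding trace_adjoint[symmetric]
    by (simp add: adjoint_matrix_inv assms adjoint_F_theta)
  then show ?thesis
    by (simp add: f_CRLB_def Reals_cnj_iff)
qed

section \<open>Differential of the trace of an inverse Schur complement\<close>

lemma trace_sandwich:
  "trace (P ** (D :: 'a::comm_semiring_1^'m^'n) ** Q) = trace (Q ** P ** D)"
  by (metis matrix_mul_assoc trace_mul_sym)

text \<open>Stated for an arbitrary differentiable \<open>W\<close>, because only the product rule,
  the derivative of the inverse and cyclicity of the trace enter; the Kronecker form of
  \<open>X_tilde\<close> is exploited afterwards.\<close>

lemma has_derivative_trace_matrix_inv_schur:
  fixes A :: "complex^'k^'p" and B :: "complex^'l^'p"
    and W :: "'x::real_normed_vector \<Rightarrow> complex^'p^'p"
  defines "S \<equiv> \<lambda>x. B\<^sup>H ** W x ** B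
    - B\<^sup>H ** W x ** A ** matrix_inv (A\<^sup>H ** W x ** A) ** A\<^sup>H ** W x ** B"
  assumes W: "(W has_derivative W') (at x)"
    and A: "invertible (A\<^sup>H ** W x ** A)"
    and S: "invertible (S x)"
  defines "U \<equiv> B ** (matrix_inv (S x) ** matrix_inv (S x)) ** B\<^sup>H"
    and "G \<equiv> matrix_inv (A\<^sup>H ** W x ** A)"
  shows "((\<lambda>y. trace (matrix_inv (S y))) has_derivative
    (\<lambda>h. trace ((- U + A ** G ** A\<^sup>H ** W x ** U
         - A ** G ** A\<^sup>H ** W x ** U ** W x ** A ** G ** A\<^sup>H
         + U ** W x ** A ** G ** A\<^sup>H) ** W' h))) (at x)"
proof -
  define G' where "G' = (\<lambda>h. - (G ** (A\<^sup>H ** W' h ** A) ** G))"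
  have l: "((\<lambda>y. P ** f y) has_derivative (\<lambda>h. P ** f' h)) (at x)"
    if "(f has_derivative f') (at x)"
    for P :: "complex^'r^'s" and f :: "'x \<Rightarrow> complex^'t^'r" and f'
    using that
    by (rule bounded_linear.has_derivative[OF
          bounded_bilinear.bounded_linear_right[OF bounded_bilinear_matrix_mult]])
  have r: "((\<lambda>y. f y ** P) has_derivative (\<lambda>h. f' h ** P)) (at x)"
    if "(f has_derivative f') (at x)"
    for P :: "complex^'t^'r" and f :: "'x \<Rightarrow> complex^'r^'s" and f'
    using that
    by (rule bounded_linear.has_derivative[OF
          bounded_bilinear.bounded_linear_left[OF bounded_bilinear_matrix_mult]])
  have G: "((\<lambda>y. matrix_inv (A\<^sup>H ** W y ** A)) has_derivative G') (at x)"
    unfolding G'_def G_def by (rule has_derivative_matrix_inv[OF r[OF l[OF W]] A])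
  \<comment> \<open>The grouping is the one the product rule yields on the left-nested products in
    \<open>S\<close>.\<close>
  let ?S' = "\<lambda>h. B\<^sup>H ** W' h ** B
    - (B\<^sup>H ** W x ** A ** G ** A\<^sup>H ** W' h
      + (B\<^sup>H ** W x ** A ** G' h + B\<^sup>H ** W' h ** A ** G) ** A\<^sup>H ** W x) ** B"
  have S': "(S has_derivative ?S') (at x)"
    unfolding S_def G_def
    by (intro has_derivative_diff r l has_derivative_matrix_mult W G[unfolded G_def])
  let ?D = "matrix_inv (S x)"
  have trace_S': "trace (- (?D ** ?S' h ** ?D)) =
      trace ((- U + A ** G ** A\<^sup>H ** W x ** U
         - A ** G ** A\<^sup>H ** W x ** U ** W x ** A ** G ** A\<^sup>H
         + U ** W x ** A ** G ** A\<^sup>H) ** W' h)" for h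
  proof -
    \<comment> \<open>Each summand contains \<open>W' h\<close> once, between some \<open>P\<close>
      ending the left part and some \<open>Q\<close>. In the rotated product \<open>Q ** P\<close>
      the two copies of \<open>?D\<close> meet as \<open>B ** ?D ** ?D ** B\<^sup>H\<close>, which
      is \<open>U\<close>. The third sign is positive because \<open>G'\<close> carries its own
      minus.\<close>
    have "?D ** ?S' h ** ?D = (?D ** B\<^sup>H) ** W' h ** (B ** ?D)
        - (?D ** B\<^sup>H ** W x ** A ** G ** A\<^sup>H) ** W' h ** (B ** ?D)
        + (?D ** B\<^sup>H ** W x ** A ** G ** A\<^sup>H) ** W' h ** (A ** G ** A\<^sup>H ** W x ** B ** ?D)
        - (?D ** B\<^sup>H) ** W' h ** (A ** G ** A\<^sup>H ** W x ** B ** ?D)"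
      by (simp add: G'_def matrix_diff_ldistrib matrix_diff_rdistrib matrix_add_ldistrib
          matrix_add_rdistrib matrix_minus_left matrix_minus_right matrix_mul_assoc)
    then show ?thesis
      by (simp only: trace_minus trace_add trace_sub trace_sandwich[where D = "W' h"])
        (simp add: U_def trace_minus trace_add trace_sub matrix_diff_ldistrib matrix_diff_rdistrib
          matrix_add_ldistrib matrix_add_rdistrib matrix_minus_left matrix_mul_assoc)
  qed
  show ?thesis
    using bounded_linear.has_derivative[OF bounded_linear_trace has_derivative_matrix_inv[OF S' S]]
    unfolding trace_S' .
qed

section \<open>Reduction of the Kronecker factor to block traces\<close>

lemma trace_mult_kronecker_mat_1: "trace (V ** (B \<otimes>\<^sub>K mat 1)) = trace (block_traces V ** B)"
proof -
  have "trace (V ** (B \<otimes>\<^sub>K mat 1)) =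
      (\<Sum>n\<in>UNIV. \<Sum>i\<in>UNIV. \<Sum>m\<in>UNIV. \<Sum>j\<in>UNIV.
        V $ (n, i) $ (m, j) * (B $ m $ n * mat 1 $ j $ i))"
    by (simp add: trace_def matrix_matrix_mult_def kronecker_def UNIV_Times_UNIV[symmetric]
        sum.cartesian_product' del: UNIV_Times_UNIV)
  also have "\<dots> = (\<Sum>n\<in>UNIV. \<Sum>i\<in>UNIV. \<Sum>m\<in>UNIV. V $ (n, i) $ (m, i) * B $ m $ n)"
    by (simp add: mat_def if_distrib cong: if_cong)
  \<comment> \<open>With \<open>j = i\<close> enforced by the identity, moving the sum over
    \<open>i\<close> innermost exposes the trace of block \<open>(n, m)\<close>.\<close>
  also have "\<dots> = (\<Sum>n\<in>UNIV. \<Sum>m\<in>UNIV. \<Sum>i\<in>UNIV. V $ (n, i) $ (m, i) * B $ m $ n)"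
    by (intro sum.cong refl sum.swap)
  also have "\<dots> = trace (block_traces V ** B)"
    by (simp add: trace_def matrix_matrix_mult_def block_traces_def block_def sum_distrib_right)
  finally show ?thesis .
qed

lemma has_derivative_f_CRLB:
  assumes "invertible (F_alpha a \<alpha> \<theta> X)" and "invertible (F_theta a \<alpha> \<theta> X)"
  shows "(f_CRLB \<sigma> a \<alpha> \<theta> has_derivative
    (\<lambda>H. of_real (\<sigma>\<^sup>2) * trace (block_traces (V_mat a \<alpha> \<theta> X) **
      (mat_cnj X ** transpose H + mat_cnj H ** transpose X)))) (at X)"
proof -
  have "((\<lambda>X. trace (matrix_inv (F_theta a \<alpha> \<theta> X))) has_derivative
    (\<lambda>H. trace (V_mat a \<alpha> \<theta> X **
      ((mat_cnj X ** transpose H + mat_cnj H ** transpose X) \<otimes>\<^sub>K mat 1)))) (at X)"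
    using has_derivative_trace_matrix_inv_schur[OF has_derivative_X_tilde[of X],
        of "T_alpha a \<alpha> \<theta>" "T_theta a \<alpha> \<theta>"] assms
    unfolding F_theta_def V_mat_def Upsilon_theta_def Upsilon_alpha_def F_alpha_def Let_def
    by simp
  then show ?thesis
    unfolding f_CRLB_def trace_mult_kronecker_mat_1
    by (rule has_derivative_mult_right)
qed

section \<open>From the real derivative to the Wirtinger gradient\<close>

lemma vector_derivative_along_line:
  assumes "(f has_derivative f') (at x)"
  shows "vector_derivative (\<lambda>s::real. f (x + s *\<^sub>R v)) (at 0) = f' v"
proof (rule vector_derivative_at)
  have "((\<lambda>s::real. x + s *\<^sub>R v) has_derivative (\<lambda>s. s *\<^sub>R v)) (at 0)"
    by (auto intro!: derivative_eq_intros)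
  then have "((\<lambda>s::real. f (x + s *\<^sub>R v)) has_derivative (\<lambda>s. f' (s *\<^sub>R v))) (at 0)"
    by (rule has_derivative_compose) (use assms in simp)
  moreover have "f' (s *\<^sub>R v) = s *\<^sub>R f' v" for s
    using has_derivative_bounded_linear[OF assms] by (simp add: linear_simps)
  ultimately show "((\<lambda>s::real. f (x + s *\<^sub>R v)) has_vector_derivative f' v) (at 0)"
    by (simp add: has_vector_derivative_def)
qed

text \<open>
  Replacing \<open>H\<close> by \<open>\<i> H\<close> multiplies the summand linear in \<open>H\<close> by \<open>\<i>\<close> and the
  conjugate-linear one by \<open>-\<i>\<close>, so the Wirtinger combination keeps only the latter.
\<close>
lemma euclidean_gradient_eqI:
  assumes "(f has_derivative
    (\<lambda>H. c * trace (B ** (mat_cnj X ** transpose H + mat_cnj H ** transpose X)))) (at X)"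
  shows "euclidean_gradient f X = (\<chi> n t. c * (transpose B ** X) $ n $ t)"
proof -
  let ?i = "\<lambda>E. \<chi> i j. \<i> * E $ i $ j"
  have i: "trace (B ** (mat_cnj X ** transpose (?i E))) =
        \<i> * trace (B ** (mat_cnj X ** transpose E))"
      "trace (B ** (mat_cnj (?i E) ** transpose X)) =
        - \<i> * trace (B ** (mat_cnj E ** transpose X))"
    for E
    by (simp_all add: trace_def matrix_matrix_mult_def transpose_def mat_cnj_def
        sum_distrib_left mult_ac sum_negf)
  have unit: "trace (B ** (mat_cnj (mat_unit n t) ** transpose X)) = (transpose B ** X) $ n $ t"
    for n t
  proof -
    \<comment> \<open>The matrix unit is real, so conjugation leaves it fixed; the product carries
      column \<open>t\<close> of \<open>X\<close> in row \<open>n\<close> and zeros elsewhere. The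
      trace then pairs this column with column \<open>n\<close> of \<open>B\<close>, whence the
      transpose.\<close>
    have "(mat_cnj (mat_unit n t) ** transpose X) $ k $ l = (if k = n then X $ l $ t else 0)" for k l
      by (auto simp: mat_unit_def mat_cnj_def matrix_matrix_mult_def transpose_def
          if_distrib[of cnj] if_distrib[of "\<lambda>z. z * _"] cong: if_cong)
    then have "trace (B ** (mat_cnj (mat_unit n t) ** transpose X)) =
        (\<Sum>l\<in>UNIV. \<Sum>k\<in>UNIV. B $ l $ k * (if k = n then X $ l $ t else 0))"
      unfolding trace_def matrix_matrix_mult_def[of B] by simp
    then show ?thesis
      by (simp add: matrix_matrix_mult_def transpose_def if_distrib cong: if_cong)
  qed
  show ?thesis
    unfolding euclidean_gradient_def vector_derivative_along_line[OF assms]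
    by (simp add: vec_eq_iff matrix_add_ldistrib trace_add i unit algebra_simps)
qed

text \<open>The first two conjuncts secure the meaning of the third:
  \<open>euclidean_gradient\<close> is the Wirtinger gradient only for a real-differentiable
  function with real values.\<close>

theorem lemma2:
  fixes \<sigma> :: real
    and a :: "real \<Rightarrow> complex^'n"
    and \<alpha> :: "complex^'k"
    and \<theta> :: "real^'k"
    and X :: "complex^'t^'n"
  assumes "\<sigma>\<^sup>2 > 0"
    and "\<And>x. a differentiable (at x)"
    and "invertible (F_alpha a \<alpha> \<theta> X)"
    and "invertible (F_theta a \<alpha> \<theta> X)"
  shows "f_CRLB \<sigma> a \<alpha> \<theta> X \<in> \<real>
    \<and> f_CRLB \<sigma> a \<alpha> \<theta> differentiable (at X)
    \<and> euclidean_gradient (f_CRLB \<sigma> a \<alpha> \<theta>) X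
           = \<sigma>\<^sup>2 *\<^sub>R (transpose (block_traces (V_mat a \<alpha> \<theta> X)) ** X)"
proof (intro conjI)
  note deriv = has_derivative_f_CRLB[OF assms(3,4), of \<sigma>]
  show "f_CRLB \<sigma> a \<alpha> \<theta> X \<in> \<real>"
    by (rule f_CRLB_real[OF assms(3,4)])
  show "f_CRLB \<sigma> a \<alpha> \<theta> differentiable (at X)"
    using deriv by (rule differentiableI)
  show "euclidean_gradient (f_CRLB \<sigma> a \<alpha> \<theta>) X
      = \<sigma>\<^sup>2 *\<^sub>R (transpose (block_traces (V_mat a \<alpha> \<theta> X)) ** X)"
    unfolding euclidean_gradient_eqI[OF deriv] 
    by (simp add: vec_eq_iff) (simp add: scaleR_conv_of_real)
qed

end
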